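(* Let $n\ge 2$ be an integer, and let $$ W_n(z) := 2\sum_{i=1}^{\left\lfloor\frac{n-1}{2}\right\rfloor} S_{n-i-2}(z)\,S_{i-1}(z)\,z^{n-i-1} + \left(S_{\left\lfloor\frac{n-2}{2}\right\rfloor}(z)\right)^2 . $$ Then $W_n(z)$ has the factorisation $$ W_n(z)=P_n(z)\,D_n(z), $$ where $P_n(z)$ is a polynomial and $$ D_n(z)=\prod_{j\ge 1} S_{\left\lfloor\frac{n-2}{2^j}\right\rfloor}(z). $$
   Context: For an integer $s\ge 0$, $S_s(z)=\prod_{i=1}^{s}(1+z^i)$, with $S_0(z)=1$ (so all but finitely many factors of $D_n(z)$ equal $1$). The polynomial $W_n(z)$ is the generating polynomial, by number of vertical dominoes when $n$ is even and by number of horizontal dominoes when $n$ is odd, of the monomino-domino tatami coverings (no four tiles meet) of the $n\times n$ grid with exactly $n$ monominoes and with a monomino in each of the two top corners. *)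

theory Defs
  imports "HOL-Computational_Algebra.Polynomial" "HOL-Library.Groups_Big_Fun"
begin

definition S :: "nat \<Rightarrow> int poly"
  where "S s = (\<Prod>i=1..s. 1 + monom 1 i)"

text \<open>
  On \<^typ>\<open>nat\<close>, \<open>div\<close> is the floor of the quotient. For \<open>n \<ge> 2\<close> no
  subtraction below truncates: in the sum, \<open>1 \<le> i \<le> (n - 1) div 2\<close> forces
  \<open>n \<ge> 3\<close> and hence \<open>i + 2 \<le> n\<close>.
\<close>

definition W :: "nat \<Rightarrow> int poly"
  where "W n = 2 * (\<Sum>i=1..(n - 1) div 2. S (n - i - 2) * S (i - 1) * monom 1 (n - i - 1))
                 + (S ((n - 2) div 2))\<^sup>2"

text \<open>
  The product over all \<open>j \<ge> 1\<close> is indexed as \<open>Suc j\<close>, \<open>j \<ge> 0\<close>. It is the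
  unrestricted product \<^const>\<open>Prod_any\<close>, which multiplies the factors different
  from \<open>1\<close>; there are finitely many of them by \<open>finite_support_D\<close> below
  (otherwise \<^const>\<open>Prod_any\<close> would be \<open>1\<close> by convention).
\<close>

definition D :: "nat \<Rightarrow> int poly"
  where "D n = (\<Prod>j. S ((n - 2) div 2 ^ Suc j))"

lemma S_0 [simp]: "S 0 = 1"
  by (simp add: S_def)

lemma support_D_subset: "{j. S ((n - 2) div 2 ^ Suc j) \<noteq> 1} \<subseteq> {..<n}"
proof (rule subsetI, rule ccontr)
  fix j assume j: "j \<in> {j. S ((n - 2) div 2 ^ Suc j) \<noteq> 1}" and "j \<notin> {..<n}"
  then have "n - 2 \<le> j" by simp
  also have "j < 2 ^ Suc j" by (rule less_trans[OF less_exp]) simp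
  finally have "(n - 2) div 2 ^ Suc j = 0" by (rule div_less)
  with j show False by (simp del: power_Suc)
qed

lemma finite_support_D: "finite {j. S ((n - 2) div 2 ^ Suc j) \<noteq> 1}"
  using support_D_subset by (rule finite_subset) simp

lemma D_eq_finite_prod: "D n = (\<Prod>j=1..n. S ((n - 2) div 2 ^ j))"
proof -
  have "D n = (\<Prod>j<n. S ((n - 2) div 2 ^ Suc j))"
    unfolding D_def by (rule Prod_any.expand_superset[OF _ support_D_subset]) simp
  also have "\<dots> = (\<Prod>j=1..n. S ((n - 2) div 2 ^ j))"
    by (rule prod.reindex_bij_witness[of _ "\<lambda>j. j - 1" Suc]) auto
  finally show ?thesis .
qed

end

theory Submission
  imports Defs "HOL-Computational_Algebra.Fundamental_Theorem_Algebra"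
begin

text \<open>
  Put \<open>N = n - 2\<close>. Every summand of \<open>W n\<close> is a multiple of some \<open>S a * S b\<close> with \<open>a + b + 1 \<ge> N\<close>,
  and each such product is already divisible by \<open>D n\<close>. To see this, compare orders of vanishing at
  a complex number \<open>x\<close>. If no power of \<open>x\<close> is \<open>-1\<close>, both orders are \<open>0\<close>. Otherwise let \<open>m > 0\<close> be
  least with \<open>x ^ m = -1\<close>. Then \<open>x ^ i = -1\<close> exactly for the odd multiples \<open>i\<close> of \<open>m\<close>, so
  \<open>S s\<close> has order \<open>\<lfloor>(s + m) / 2m\<rfloor>\<close>. The sum of these over \<open>s = \<lfloor>N / 2\<^sup>j\<rfloor>\<close>, \<open>j \<ge> 1\<close>, telescopes to
  \<open>\<lfloor>N / 2m\<rfloor>\<close>, while \<open>\<lfloor>u / k\<rfloor> + \<lfloor>v / k\<rfloor> \<ge> \<lfloor>(u + v + 1) / k\<rfloor> - 1\<close> gives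
  \<open>\<lfloor>(a + m) / 2m\<rfloor> + \<lfloor>(b + m) / 2m\<rfloor> \<ge> \<lfloor>(a + b + 1) / 2m\<rfloor>\<close>. Divisibility over the complex numbers
  descends to the integers because \<open>D n\<close> is monic.
\<close>

text \<open>Both polynomials split into linear factors over the complex numbers, so divisibility can
  be checked root by root.\<close>

lemma dvd_complex_poly_if_order_le:
  fixes p q :: "complex poly"
  assumes "p \<noteq> 0" and "\<And>x. order x p \<le> order x q"
  shows "p dvd q"
proof (cases "q = 0")
  case False
  let ?P = "\<lambda>r s :: complex poly. \<Prod>z | poly r z = 0. [:- z, 1:] ^ order z s"
  have "{z. poly p z = 0} \<subseteq> {z. poly q z = 0}"
  proof (rule Collect_mono, rule impI)
    fix z assume "poly p z = 0"
    with assms(1) have "order z p > 0" by (simp add: order_gt_0_iff)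
    also note assms(2)
    finally show "poly q z = 0" using False by (simp add: order_gt_0_iff)
  qed
  then have "?P p p dvd ?P q q"
    using assms(2) poly_roots_finite[OF False]
    by (intro prod_dvd_prod_subset2) (auto intro: le_imp_power_dvd)
  then have "smult (lead_coeff p) (?P p p) dvd smult (lead_coeff q) (?P q q)"
    using assms(1) by (simp add: smult_dvd_iff dvd_smult)
  then show ?thesis
    by (simp only: complex_poly_decompose)
qed simp

abbreviation complex_poly :: "int poly \<Rightarrow> complex poly"
  where "complex_poly \<equiv> map_poly of_int"

lemma complex_poly_add: "complex_poly (p + q) = complex_poly p + complex_poly q"
  by (rule poly_eqI) (simp add: coeff_map_poly)

lemma complex_poly_mult: "complex_poly (p * q) = complex_poly p * complex_poly q"
  by (rule poly_eqI) (simp add: coeff_map_poly coeff_mult)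

lemma complex_poly_prod: "complex_poly (prod f A) = (\<Prod>i\<in>A. complex_poly (f i))"
  by (induction A rule: infinite_finite_induct) (simp_all add: complex_poly_mult)

text \<open>Pseudo-division works over the integers at the cost of a factor \<open>a\<close>. Over
  the complex numbers \<open>p\<close> divides the remainder, which is zero by degree;
  \<open>a\<close> cancels since \<open>p\<close> is monic.\<close>

lemma monic_dvd_if_complex_poly_dvd:
  assumes monic: "lead_coeff p = 1" and dvd: "complex_poly p dvd complex_poly q"
  shows "p dvd q"
proof -
  from monic have "p \<noteq> 0" by auto
  then obtain a k r where a: "a \<noteq> 0" and div: "smult a q = p * k + r"
    and r: "r = 0 \<or> degree r < degree p"
    using pseudo_mod[of p q] by blast
  have "complex_poly p dvd complex_poly (smult a q)"
    using dvd by (simp add: map_poly_smult dvd_smult)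
  then have "complex_poly p dvd complex_poly r"
    by (simp add: div complex_poly_add complex_poly_mult dvd_add_right_iff)
  moreover have "degree (complex_poly r) = degree r" "degree (complex_poly p) = degree p"
    by (simp_all add: degree_map_poly)
  ultimately have "complex_poly r = 0"
    using r by (auto dest: dvd_imp_degree_le)
  then have "r = 0"
    by (simp add: map_poly_eq_0_iff)
  with div have "p dvd smult a q" by simp
  with monic show ?thesis using a by (rule dvd_monic)
qed

lemma order_one_plus_monom:
  fixes x :: complex
  assumes "i > 0"
  shows "order x (1 + monom 1 i) = (if x ^ i = -1 then 1 else 0)"
proof -
  let ?p = "1 + monom 1 i :: complex poly"
  have root: "poly ?p x = 0 \<longleftrightarrow> x ^ i = -1" for x
    by (simp add: poly_monom add_eq_0_iff eq_commute[of _ "-1"] minus_equation_iff)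
  have nz: "?p \<noteq> 0"
    by (metis root poly_0 one_neq_neg_one power_one)
  \<comment> \<open>The derivative can vanish only at \<open>0\<close>, which is not a root, so
    every root is simple.\<close>
  have "rsquarefree ?p"
    using assms by (auto simp: rsquarefree_roots root pderiv_add pderiv_monom poly_monom power_0_left)
  then show ?thesis
    using root[of x] nz by (auto simp: rsquarefree_root_order order_0I)
qed

lemma power_eq_minus_one_iff:
  fixes x :: complex
  assumes m: "m > 0" "x ^ m = -1" and least: "\<And>k. 0 < k \<Longrightarrow> x ^ k = -1 \<Longrightarrow> m \<le> k"
  shows "x ^ i = -1 \<longleftrightarrow> 2 * m dvd i + m"
proof -
  have per: "x ^ (2 * m) = 1"
    using m(2) by (simp add: power_mult mult.commute[of 2])
  show ?thesis
  proof
    assume "2 * m dvd i + m"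
    then obtain c where "i + m = 2 * m * c" ..
    then have "x ^ (i + m) = 1"
      using per by (simp add: power_mult)
    then have "- (x ^ i) = 1"
      using m(2) by (simp add: power_add)
    then show "x ^ i = -1"
      by (metis minus_minus)
  next
    assume i: "x ^ i = -1"
    define r where "r = (i + m) mod (2 * m)"
    have "x ^ (i + m) = x ^ (2 * m * ((i + m) div (2 * m)) + r)"
      by (simp add: r_def)
    then have xr: "x ^ r = 1"
      using i m(2) per by (simp add: power_add power_mult)
    have "r < 2 * m"
      using m(1) by (simp add: r_def)
    have "r = 0"
    proof (rule ccontr)
      assume "r \<noteq> 0"
      \<comment> \<open>If \<open>r = m\<close>, then \<open>x ^ m\<close> is both \<open>1\<close>
        and \<open>-1\<close>. Otherwise the distance between \<open>r\<close> and \<open>m\<close>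
        is a positive exponent below \<open>m\<close> at which the power is \<open>-1\<close>,
        against minimality.\<close>
      consider "r < m" | "r = m" | "m < r" by linarith
      then show False
      proof cases
        case 1
        then have "x ^ r * x ^ (m - r) = -1"
          using m(2) by (simp flip: power_add)
        then show False
          using least[of "m - r"] xr 1 \<open>r \<noteq> 0\<close> by simp
      next
        case 2
        then show False using xr m(2) by simp
      next
        case 3
        then have "x ^ m * x ^ (r - m) = 1"
          using xr by (simp flip: power_add)
        then have "- (x ^ (r - m)) = 1"
          using m(2) by simp
        then have "x ^ (r - m) = -1"
          by (metis minus_minus)
        then show False
          using least[of "r - m"] 3 \<open>r < 2 * m\<close> by simp
      qed
    qed
    then show "2 * m dvd i + m"
      by (simp add: r_def dvd_eq_mod_eq_0)
  qed
qed

lemma lead_coeff_S: "lead_coeff (S s) = 1"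
proof -
  have "lead_coeff (1 + monom 1 i :: int poly) = 1" if "i \<in> {1..s}" for i
    using that by (subst lead_coeff_add_le) (simp_all add: degree_monom_eq)
  then show ?thesis
    by (simp add: S_def lead_coeff_prod)
qed

lemma lead_coeff_D: "lead_coeff (D n) = 1"
  by (simp add: D_eq_finite_prod lead_coeff_prod lead_coeff_S)

lemma complex_poly_nonzero_if_monic: "lead_coeff p = 1 \<Longrightarrow> complex_poly p \<noteq> 0"
  by (auto simp: map_poly_eq_0_iff)

lemma S_Suc: "S (Suc s) = S s * (1 + monom 1 (Suc s))"
  by (simp add: S_def)

lemma order_S_Suc:
  "order x (complex_poly (S (Suc s))) =
     order x (complex_poly (S s)) + (if x ^ Suc s = -1 then 1 else 0)"
proof -
  have "complex_poly (S (Suc s)) = complex_poly (S s) * (1 + monom 1 (Suc s))"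
    by (simp add: S_Suc complex_poly_mult complex_poly_add map_poly_monom)
  then show ?thesis
    using complex_poly_nonzero_if_monic[OF lead_coeff_S, of "Suc s"]
    by (simp add: order_mult order_one_plus_monom del: power_Suc)
qed

lemma order_S_eq_0:
  assumes "\<And>k. 0 < k \<Longrightarrow> x ^ k \<noteq> -1"
  shows "order x (complex_poly (S s)) = 0"
  using assms by (induction s) (simp_all add: order_S_Suc del: power_Suc)

text \<open>As \<open>s\<close> grows, the quotient starts at \<open>0\<close> and increases by one
  exactly when \<open>2 * m\<close> divides \<open>s + m\<close>, that is, when the new factor of
  \<open>S s\<close> vanishes at \<open>x\<close>.\<close>

lemma order_S:
  assumes m: "m > 0" "x ^ m = -1" and least: "\<And>k. 0 < k \<Longrightarrow> x ^ k = -1 \<Longrightarrow> m \<le> k"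
  shows "order x (complex_poly (S s)) = (s + m) div (2 * m)"
proof (induction s)
  case (Suc s)
  then show ?case
    using power_eq_minus_one_iff[OF assms, of "Suc s"]
    by (simp add: order_S_Suc div_Suc dvd_eq_mod_eq_0 del: power_Suc)
qed (use m in simp)

lemma order_D: "order x (complex_poly (D n)) = (\<Sum>j=1..n. order x (complex_poly (S ((n - 2) div 2 ^ j))))"
proof -
  have "order x (\<Prod>j\<in>A. f j) = (\<Sum>j\<in>A. order x (f j))"
    if "finite A" "\<And>j. j \<in> A \<Longrightarrow> f j \<noteq> 0" for A and f :: "nat \<Rightarrow> complex poly"
    using that by (induction A rule: finite_induct) (auto simp: order_mult)
  then show ?thesis
    by (simp add: D_eq_finite_prod complex_poly_prod complex_poly_nonzero_if_monic lead_coeff_S)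
qed

text \<open>The tail term makes the induction close: each step splits a quotient \<open>q\<close> as
  \<open>(q + 1) div 2 + q div 2\<close>.\<close>

lemma sum_halves_telescope:
  fixes N m :: nat
  assumes "m > 0"
  shows "(\<Sum>j=1..k. (N div 2 ^ j + m) div (2 * m)) + N div 2 ^ k div (2 * m) = N div (2 * m)"
proof (induction k)
  case (Suc k)
  define M where "M = N div 2 ^ k"
  define q where "q = M div 2 div m"
  have M: "N div 2 ^ Suc k = M div 2" "M div (2 * m) = q"
    by (simp_all add: M_def q_def mult.assoc flip: div_mult2_eq) (simp add: mult.commute)
  have "(M div 2 + m) div (2 * m) = (q + 1) div 2" "M div 2 div (2 * m) = q div 2"
    using assms by (simp_all add: q_def mult.commute[of 2] div_mult2_eq[of _ m 2])
  then have "(M div 2 + m) div (2 * m) + M div 2 div (2 * m) = q"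
    by simp
  with Suc show ?case
    by (simp add: M del: power_Suc flip: M_def)
qed simp

lemma div_add_div_ge:
  fixes u v k N :: nat
  assumes "k > 0" and "N + k \<le> u + v + 1"
  shows "N div k \<le> u div k + v div k"
proof -
  have "u < k * (u div k) + k" "v < k * (v div k) + k"
    using dividend_less_times_div[OF assms(1)] by (simp_all add: add.commute)
  then have "N < k * (u div k + v div k + 1)"
    using assms(2) by (simp add: algebra_simps)
  then show ?thesis
    using assms(1) by (metis Suc_eq_plus1 div_less_iff_less_mult less_Suc_eq_le mult.commute)
qed

lemma D_dvd_S_mult_S:
  assumes "n \<le> a + b + 3"
  shows "D n dvd S a * S b"
proof (intro monic_dvd_if_complex_poly_dvd dvd_complex_poly_if_order_le)
  fix x :: complex
  have nz: "complex_poly (S a) * complex_poly (S b) \<noteq> 0"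
    by (simp add: complex_poly_nonzero_if_monic lead_coeff_S)
  show "order x (complex_poly (D n)) \<le> order x (complex_poly (S a * S b))"
  proof (cases "\<exists>k>0. x ^ k = -1")
    case True
    define m where "m = (LEAST k. k > 0 \<and> x ^ k = -1)"
    have m: "m > 0" "x ^ m = -1"
      using LeastI_ex[OF True] by (simp_all add: m_def)
    have least: "m \<le> k" if "0 < k" "x ^ k = -1" for k
      unfolding m_def using that by (intro Least_le) simp
    note ord = order_S[OF m least]
    \<comment> \<open>Dropping the nonnegative tail leaves an upper bound.\<close>
    have "order x (complex_poly (D n)) \<le> (n - 2) div (2 * m)"
      using sum_halves_telescope[OF m(1), of "n - 2" n] by (simp add: order_D ord)
    also have "\<dots> \<le> (a + m) div (2 * m) + (b + m) div (2 * m)"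
      using assms m(1) by (intro div_add_div_ge) auto
    also have "\<dots> = order x (complex_poly (S a * S b))"
      using nz by (simp add: complex_poly_mult order_mult ord)
    finally show ?thesis .
  next
    case False
    then have "order x (complex_poly (S s)) = 0" for s
      by (intro order_S_eq_0) (use False in blast)
    then show ?thesis by (simp add: order_D)
  qed
qed (simp_all add: complex_poly_nonzero_if_monic lead_coeff_D)

theorem theorem3:
  fixes n :: nat
  assumes "n \<ge> 2"
  shows "\<exists>P :: int poly. W n = P * D n"
proof -
  have "D n dvd W n"
    \<comment> \<open>In the sum, the indices \<open>n - i - 2\<close> and \<open>i - 1\<close> add
      up to exactly \<open>n - 3\<close>. In the square, twice \<open>(n - 2) div 2\<close> is at
      least \<open>n - 3\<close>, with equality for odd \<open>n\<close>.\<close>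
    unfolding W_def power2_eq_square
    by (intro dvd_add dvd_mult dvd_sum dvd_mult2 D_dvd_S_mult_S) auto
  then show ?thesis
    by (metis dvdE mult.commute)
qed

end
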